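(* Let $k\ge 3$ be an integer and let $A\in SL_n(\mathbb{C})$. Suppose there is a matrix $B\in SL_n(\mathbb{C})$ such that $A=-B^{2k}$ and $B$ is the product of one matrix $C$ of skew order $2k$ and one matrix $D$ of order $2k$. Then $A$ is a product of $4k-3$ commutators of these elements, i.e. commutators in which the entries are powers of $C$ and powers of $D$ (one entry a power of $C$, the other a power of $D$).
   Context: A matrix $X\in GL_n(\mathbb C)$ is of order $2k$ if $X^{2k}=I$, and of skew order $2k$ if $X^{2k}=-I$. The commutator is $[X,Y]=XYX^{-1}Y^{-1}$. Powers may have any integer exponent. *)

theory Defs
  imports
    "Jordan_Normal_Form.Determinant"
    Complex_Main
begin

definition GL :: "nat \<Rightarrow> complex mat monoid" where
  "GL n = units_of (ring_mat TYPE(complex) n ())"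

definition SL :: "nat \<Rightarrow> complex mat set" where
  "SL n = {X \<in> carrier_mat n n. det X = 1}"

(* "X is of order m" only means that X ^ m is the identity: m need not be minimal,
   in contrast to group.ord. *)
definition of_order :: "nat \<Rightarrow> nat \<Rightarrow> complex mat \<Rightarrow> bool" where
  "of_order n m X \<longleftrightarrow> X \<in> carrier (GL n) \<and> X ^\<^sub>m m = 1\<^sub>m n"

definition of_skew_order :: "nat \<Rightarrow> nat \<Rightarrow> complex mat \<Rightarrow> bool" where
  "of_skew_order n m X \<longleftrightarrow> X \<in> carrier (GL n) \<and> X ^\<^sub>m m = - 1\<^sub>m n"

definition commutator :: "('a, 'b) monoid_scheme \<Rightarrow> 'a \<Rightarrow> 'a \<Rightarrow> 'a" where
  "commutator G x y = x \<otimes>\<^bsub>G\<^esub> y \<otimes>\<^bsub>G\<^esub> inv\<^bsub>G\<^esub> x \<otimes>\<^bsub>G\<^esub> inv\<^bsub>G\<^esub> y"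

definition power_commutators :: "('a, 'b) monoid_scheme \<Rightarrow> 'a \<Rightarrow> 'a \<Rightarrow> 'a set" where
  "power_commutators G c d =
     {commutator G (c [^]\<^bsub>G\<^esub> i) (d [^]\<^bsub>G\<^esub> j) | (i :: int) (j :: int). True} \<union>
     {commutator G (d [^]\<^bsub>G\<^esub> j) (c [^]\<^bsub>G\<^esub> i) | (i :: int) (j :: int). True}"

end

theory Submission
  imports Defs
begin

text \<open>
  In any group, \<open>x y = [x, y] y x\<close> gives
  \<open>c\<^sup>s d\<^sup>s \<cdot> c d = [c\<^sup>s, d\<^sup>s] [d\<^sup>s, c\<^sup>s\<^sup>+\<^sup>1] \<cdot> c\<^sup>s\<^sup>+\<^sup>1 d\<^sup>s\<^sup>+\<^sup>1\<close>, so by induction \<open>(c d)\<^sup>m\<close>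
  is a product of \<open>2 (m - 1)\<close> commutators times \<open>c\<^sup>m d\<^sup>m\<close>. If \<open>c\<^sup>m\<close> is central, the last
  commutator is trivial, leaving \<open>2 m - 3\<close>. For \<open>m = 2 k\<close> this is \<open>4 k - 3\<close>, and
  \<open>C\<^sup>m D\<^sup>m = -I\<close> cancels the sign in \<open>A = -B\<^sup>m\<close>.
\<close>

lemma (in monoid) foldr_mult_closed:
  assumes "set xs \<subseteq> carrier G"
  shows "foldr (\<otimes>) xs \<one> \<in> carrier G"
  using assms by (induction xs) auto

text \<open>\<open>foldr\<close> ends with the unit on the right, so a new last factor has to be
  slipped in before it. The inductive products below grow at this end.\<close>

lemma (in monoid) foldr_mult_snoc:
  assumes "set xs \<subseteq> carrier G" "x \<in> carrier G"
  shows "foldr (\<otimes>) (xs @ [x]) \<one> = foldr (\<otimes>) xs \<one> \<otimes> x"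
  using assms by (induction xs) (auto simp: m_assoc foldr_mult_closed)

context group
begin

lemma commutator_closed [simp]:
  assumes "x \<in> carrier G" "y \<in> carrier G"
  shows "commutator G x y \<in> carrier G"
  using assms by (simp add: commutator_def)

text \<open>The trailing factors \<open>inv x\<close> and \<open>inv y\<close> combine to the
  inverse of \<open>y \<otimes> x\<close>, which cancels.\<close>

lemma commutator_mult_swap:
  assumes "x \<in> carrier G" "y \<in> carrier G"
  shows "commutator G x y \<otimes> (y \<otimes> x) = x \<otimes> y"
  using assms by (simp add: commutator_def m_assoc flip: inv_mult_group)

lemma power_commutators_closed:
  assumes "c \<in> carrier G" "d \<in> carrier G"
  shows "power_commutators G c d \<subseteq> carrier G"
  using assms by (auto simp: power_commutators_def commutator_closed)

text \<open>Both orders of the entries are collected in the set; this symmetry lets \<open>C\<close>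
  and \<open>D\<close> exchange roles when \<open>B = D * C\<close>.\<close>

lemma power_commutators_swap: "power_commutators G d c = power_commutators G c d"
  unfolding power_commutators_def by blast

lemma commutator_nat_pow_mem:
  fixes i j :: nat
  shows "commutator G (c [^] i) (d [^] j) \<in> power_commutators G c d"
    and "commutator G (d [^] j) (c [^] i) \<in> power_commutators G c d"
  unfolding power_commutators_def int_pow_int[symmetric] by blast+

text \<open>Only the first of the two swaps is done here. The second one costs a commutator in the
  general step but is free in the last step, so each user completes it separately.\<close>

lemma pow_mult_pow_mult:
  fixes s :: nat
  assumes [simp]: "c \<in> carrier G" "d \<in> carrier G"
  shows "(c [^] s \<otimes> d [^] s) \<otimes> (c \<otimes> d)
           = commutator G (c [^] s) (d [^] s) \<otimes> ((d [^] s \<otimes> c [^] Suc s) \<otimes> d)"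
proof -
  let ?x = "c [^] s" and ?y = "d [^] s"
  have "(?x \<otimes> ?y) \<otimes> (c \<otimes> d) = (commutator G ?x ?y \<otimes> (?y \<otimes> ?x)) \<otimes> (c \<otimes> d)"
    by (simp add: commutator_mult_swap)
  also have "\<dots> = commutator G ?x ?y \<otimes> ((?y \<otimes> (?x \<otimes> c)) \<otimes> d)"
    by (simp add: m_assoc commutator_closed)
  finally show ?thesis by simp
qed

text \<open>Writing the exponent as \<open>Suc j\<close> turns the count 2 (m - 1) into
  \<open>2 * j\<close>, free of truncated subtraction.\<close>

lemma mult_pow_Suc_commutators:
  fixes j :: nat
  assumes [simp]: "c \<in> carrier G" "d \<in> carrier G"
  shows "\<exists>xs. length xs = 2 * j \<and> set xs \<subseteq> power_commutators G c d \<and>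
           (c \<otimes> d) [^] Suc j = foldr (\<otimes>) xs \<one> \<otimes> (c [^] Suc j \<otimes> d [^] Suc j)"
proof (induction j)
  case 0
  show ?case by simp
next
  case (Suc j)
  let ?s = "Suc j"
  let ?x = "c [^] ?s" and ?y = "d [^] ?s" and ?z = "c [^] Suc ?s"
  let ?p = "commutator G ?x ?y" and ?q = "commutator G ?y ?z"
  from Suc obtain xs where xs: "length xs = 2 * j" "set xs \<subseteq> power_commutators G c d"
    and eq: "(c \<otimes> d) [^] ?s = foldr (\<otimes>) xs \<one> \<otimes> (?x \<otimes> ?y)" by blast
  have sub: "set xs \<subseteq> carrier G"
    using xs(2) power_commutators_closed[of c d] by auto
  have cl: "?y \<in> carrier G" "?z \<in> carrier G" "?p \<in> carrier G" "?q \<in> carrier G"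
    by simp_all
  have [simp]: "foldr (\<otimes>) xs \<one> \<in> carrier G"
    using sub by (rule foldr_mult_closed)
  have prod: "foldr (\<otimes>) ((xs @ [?p]) @ [?q]) \<one> = (foldr (\<otimes>) xs \<one> \<otimes> ?p) \<otimes> ?q"
  proof -
    have "set (xs @ [?p]) \<subseteq> carrier G"
      using sub by simp
    then show ?thesis
      using sub by (simp only: foldr_mult_snoc cl)
  qed
  have "(c \<otimes> d) [^] Suc ?s = foldr (\<otimes>) xs \<one> \<otimes> (?x \<otimes> ?y) \<otimes> (c \<otimes> d)"
    by (simp only: nat_pow_Suc[of _ ?s] eq)
  also have "\<dots> = foldr (\<otimes>) xs \<one> \<otimes> ((?x \<otimes> ?y) \<otimes> (c \<otimes> d))"
    by (rule m_assoc) simp_all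
  \<comment> \<open>The second swap: \<open>commutator_mult_swap\<close> collapses
    \<open>?q \<otimes> (?z \<otimes> ?y)\<close> to \<open>?y \<otimes> ?z\<close>.\<close>
  also have "\<dots> = foldr (\<otimes>) xs \<one> \<otimes> (?p \<otimes> ((?q \<otimes> (?z \<otimes> ?y)) \<otimes> d))"
    by (simp only: pow_mult_pow_mult assms commutator_mult_swap cl)
  also have "\<dots> = ((foldr (\<otimes>) xs \<one> \<otimes> ?p) \<otimes> ?q) \<otimes> (?z \<otimes> (?y \<otimes> d))"
    by (simp add: m_assoc)
  also have "\<dots> = foldr (\<otimes>) ((xs @ [?p]) @ [?q]) \<one> \<otimes> (?z \<otimes> d [^] Suc ?s)"
    by (simp only: prod nat_pow_Suc[of d ?s])
  finally have "(c \<otimes> d) [^] Suc ?s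
      = foldr (\<otimes>) ((xs @ [?p]) @ [?q]) \<one> \<otimes> (?z \<otimes> d [^] Suc ?s)" .
  moreover have "set ((xs @ [?p]) @ [?q]) \<subseteq> power_commutators G c d"
    unfolding set_append list.set using xs(2) commutator_nat_pow_mem by blast
  moreover have "length ((xs @ [?p]) @ [?q]) = 2 * Suc j"
    using xs(1) by simp
  ultimately show ?case by blast
qed

text \<open>The assumption \<open>comm\<close> is exactly what makes the very last commutator, that
  of \<open>d [^] (m - 1)\<close> and \<open>c [^] m\<close>, trivial.\<close>

lemma mult_pow_commutators:
  fixes m :: nat
  assumes [simp]: "c \<in> carrier G" "d \<in> carrier G" and "m \<ge> 2"
    and comm: "c [^] m \<otimes> d [^] (m - 1) = d [^] (m - 1) \<otimes> c [^] m"
  shows "\<exists>xs. length xs = 2 * m - 3 \<and> set xs \<subseteq> power_commutators G c d \<and>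
           (c \<otimes> d) [^] m = foldr (\<otimes>) xs \<one> \<otimes> (c [^] m \<otimes> d [^] m)"
proof -
  obtain j where m: "m = Suc (Suc j)"
    using \<open>m \<ge> 2\<close> by (metis add_2_eq_Suc le_Suc_ex)
  let ?s = "Suc j"
  let ?x = "c [^] ?s" and ?y = "d [^] ?s" and ?z = "c [^] m"
  let ?p = "commutator G ?x ?y"
  \<comment> \<open>The general count is applied to the exponent m - 1 and gives 2 (m - 2)
    commutators; the last factor \<open>c \<otimes> d\<close> adds only \<open>?p\<close>.\<close>
  obtain xs where xs: "length xs = 2 * j" "set xs \<subseteq> power_commutators G c d"
    and eq: "(c \<otimes> d) [^] ?s = foldr (\<otimes>) xs \<one> \<otimes> (?x \<otimes> ?y)"
    using mult_pow_Suc_commutators[of c d j] by auto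
  have sub: "set xs \<subseteq> carrier G"
    using xs(2) power_commutators_closed[of c d] by auto
  have [simp]: "foldr (\<otimes>) xs \<one> \<in> carrier G"
    using sub by (rule foldr_mult_closed)
  have prod: "foldr (\<otimes>) (xs @ [?p]) \<one> = foldr (\<otimes>) xs \<one> \<otimes> ?p"
    by (rule foldr_mult_snoc) (simp_all add: sub)
  have "(c \<otimes> d) [^] m = foldr (\<otimes>) xs \<one> \<otimes> (?x \<otimes> ?y) \<otimes> (c \<otimes> d)"
    by (simp only: m nat_pow_Suc[of _ ?s] eq)
  also have "\<dots> = foldr (\<otimes>) xs \<one> \<otimes> ((?x \<otimes> ?y) \<otimes> (c \<otimes> d))"
    by (rule m_assoc) simp_all
  also have "\<dots> = foldr (\<otimes>) xs \<one> \<otimes> (?p \<otimes> ((?z \<otimes> ?y) \<otimes> d))"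
    using comm by (simp only: pow_mult_pow_mult assms(1,2) m diff_Suc_1)
  also have "\<dots> = (foldr (\<otimes>) xs \<one> \<otimes> ?p) \<otimes> (?z \<otimes> (?y \<otimes> d))"
    by (simp add: m_assoc)
  also have "\<dots> = foldr (\<otimes>) (xs @ [?p]) \<one> \<otimes> (?z \<otimes> d [^] m)"
    by (simp only: prod m nat_pow_Suc[of d ?s])
  finally have "(c \<otimes> d) [^] m = foldr (\<otimes>) (xs @ [?p]) \<one> \<otimes> (?z \<otimes> d [^] m)" .
  moreover have "set (xs @ [?p]) \<subseteq> power_commutators G c d"
    unfolding set_append list.set using xs(2) commutator_nat_pow_mem by blast
  moreover have "length (xs @ [?p]) = 2 * m - 3"
    using xs(1) m by simp
  ultimately show ?thesis by blast
qed

end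

lemma group_GL: "group (GL n)"
proof -
  interpret ring "ring_mat TYPE(complex) n ()" by (rule ring_mat)
  show ?thesis unfolding GL_def by (rule units_group)
qed

lemma mult_GL: "mult (GL n) = (*)"
  by (simp add: GL_def units_of_mult ring_mat_def)

lemma one_GL: "one (GL n) = 1\<^sub>m n"
  by (simp add: GL_def units_of_one ring_mat_def)

lemma GL_carrier_mat: "X \<in> carrier (GL n) \<Longrightarrow> X \<in> carrier_mat n n"
  by (auto simp: GL_def units_of_carrier Units_def ring_mat_def)

text \<open>Both powers multiply by \<open>X\<close> on the right. They agree at exponent 0 because
  the matrix power starts from the identity of size \<open>dim_row X\<close>, which is
  \<open>n\<close> here.\<close>

lemma pow_GL:
  fixes m :: nat
  assumes "X \<in> carrier (GL n)"
  shows "X [^]\<^bsub>GL n\<^esub> m = X ^\<^sub>m m"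
proof -
  interpret group "GL n" by (rule group_GL)
  show ?thesis
    using GL_carrier_mat[OF assms] by (induction m) (simp_all add: mult_GL one_GL)
qed

text \<open>The sign may sit on either factor, so that both orders of the product in the theorem are
  covered.\<close>

lemma neg_mult_pow_commutators:
  fixes m :: nat
  assumes C: "C \<in> carrier (GL n)" and D: "D \<in> carrier (GL n)" and "m \<ge> 2"
    and pow: "C ^\<^sub>m m = 1\<^sub>m n \<and> D ^\<^sub>m m = - 1\<^sub>m n \<or> C ^\<^sub>m m = - 1\<^sub>m n \<and> D ^\<^sub>m m = 1\<^sub>m n"
  shows "\<exists>xs. length xs = 2 * m - 3 \<and> set xs \<subseteq> power_commutators (GL n) C D \<and>
           - ((C * D) ^\<^sub>m m) = foldr (*) xs (1\<^sub>m n)"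
proof -
  interpret group "GL n" by (rule group_GL)
  have CD: "C * D \<in> carrier (GL n)"
    using m_closed[OF C D] by (simp add: mult_GL)
  have E: "D ^\<^sub>m (m - 1) \<in> carrier_mat n n"
    using GL_carrier_mat[OF D] by (rule pow_carrier_mat)
  \<comment> \<open>This is \<open>comm\<close> for matrices: \<open>C ^\<^sub>m m\<close> is plus
    or minus the identity, hence commutes with every matrix of size n.\<close>
  have "C ^\<^sub>m m * D ^\<^sub>m (m - 1) = D ^\<^sub>m (m - 1) * C ^\<^sub>m m"
    using pow
  proof (elim disjE conjE)
    assume "C ^\<^sub>m m = 1\<^sub>m n"
    then show ?thesis
      using left_mult_one_mat[OF E] right_mult_one_mat[OF E] by simp
  next
    assume "C ^\<^sub>m m = - 1\<^sub>m n"
    then show ?thesis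
      using left_mult_one_mat[OF E] right_mult_one_mat[OF E] carrier_matD[OF E]
        uminus_mult_left_mat[of "1\<^sub>m n" "D ^\<^sub>m (m - 1)"]
        uminus_mult_right_mat[of "D ^\<^sub>m (m - 1)" "1\<^sub>m n"]
      by (simp del: One_nat_def)
  qed
  then obtain xs where xs: "length xs = 2 * m - 3" "set xs \<subseteq> power_commutators (GL n) C D"
    and eq: "(C * D) ^\<^sub>m m = foldr (*) xs (1\<^sub>m n) * (C ^\<^sub>m m * D ^\<^sub>m m)"
    using mult_pow_commutators[OF C D \<open>m \<ge> 2\<close>]
    by (auto simp: pow_GL[OF C] pow_GL[OF D] pow_GL[OF CD] mult_GL one_GL)
  have P: "foldr (*) xs (1\<^sub>m n) \<in> carrier_mat n n"
    using foldr_mult_closed[of xs] xs(2) power_commutators_closed[OF C D]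
    by (auto simp: mult_GL one_GL intro: GL_carrier_mat)
  \<comment> \<open>Exactly one of the two powers carries the minus sign, and this sign cancels the
    one in front of the power of \<open>C * D\<close>.\<close>
  have "C ^\<^sub>m m * D ^\<^sub>m m = - 1\<^sub>m n"
    using pow by auto
  with eq P have "- ((C * D) ^\<^sub>m m) = foldr (*) xs (1\<^sub>m n)"
    by simp
  with xs show ?thesis by blast
qed

theorem theorem1p4:
  fixes n k :: nat and A B C D :: "complex mat"
  assumes "k \<ge> 3"
    and "A \<in> SL n"
    and "B \<in> SL n"
    and "A = - (B ^\<^sub>m (2 * k))"
    and "of_skew_order n (2 * k) C"
    and "of_order n (2 * k) D"
    and "B = C * D \<or> B = D * C"
  shows "\<exists>xs. length xs = 4 * k - 3 \<and> set xs \<subseteq> power_commutators (GL n) C D \<and>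
           A = foldr (*) xs (1\<^sub>m n)"
proof -
  interpret group "GL n" by (rule group_GL)
  have C: "C \<in> carrier (GL n)" "C ^\<^sub>m (2 * k) = - 1\<^sub>m n"
    and D: "D \<in> carrier (GL n)" "D ^\<^sub>m (2 * k) = 1\<^sub>m n"
    using assms(5,6) by (auto simp: of_skew_order_def of_order_def)
  have k: "2 * k \<ge> 2" "2 * (2 * k) - 3 = 4 * k - 3"
    using assms(1) by auto
  from assms(7) show ?thesis
  proof
    assume "B = C * D"
    then show ?thesis
      using neg_mult_pow_commutators[OF C(1) D(1) k(1)] C(2) D(2) k(2) assms(4) by simp
  next
    \<comment> \<open>With \<open>D\<close> as the first factor the sign falls on the second one,
      the first alternative of the sign condition.\<close>
    assume "B = D * C"
    then show ?thesis
      using neg_mult_pow_commutators[OF D(1) C(1) k(1)] C(2) D(2) k(2) assms(4)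
      by (simp add: power_commutators_swap)
  qed
qed

end
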